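(* Let $d\ge1$. The number of distinct cubic subpatterns of linear size $n$ in a $d$-dimensional paperfolding structure grows at most as $\text{const}\cdot n^d$; that is, there is a constant $C$ (depending only on $d$) such that for every integer $n\ge1$ this number is at most $C\,n^d$.
   Context: Crease patterns. For $\boldsymbol{x}\in\mathbb{Z}^d$ and $k\in\{1,\dots,d\}$ let $F_k(\boldsymbol{x})=\{y\in\mathbb{R}^d: y_k=x_k,\ x_i\le y_i\le x_i+1 \text{ for } i\ne k\}$ be the unit face perpendicular to the $k$-th axis. A crease pattern on a set of such faces assigns to each of them a sign $+$ (valley) or $-$ (crest). For a crease pattern $P$, $m_i'P$ denotes the pattern obtained by reflecting $P$ in the hyperplane $x_i=0$ and then exchanging all signs $+\leftrightarrow-$. The $m_i'$ are commuting involutions. For $\boldsymbol\phi\in\{1,-1\}^d$ put $M(\boldsymbol\phi)=\prod_{\{i:\phi_i=-1\}}m_i'$. Finite paperfolding structures. $S_d(n)$ is a crease pattern on the unit faces lying in $[-2^{n-1},2^{n-1}]^d$ but not in its boundary, defined recursively: $S_d(0)=\emptyset$, and $S_d(n+1)$ is obtained as follows. (i) A face $F_k(\boldsymbol{x})$ with $x_k=0$ gets the sign $\mathrm{sign}\big(\prod_{i<k}\sigma_i\big)$, where $\sigma_i=1$ if $x_i\ge0$ and $\sigma_i=-1$ if $x_i<0$ (empty product $=1$). (ii) For each $\boldsymbol\phi\in\{\pm1\}^d$, the faces with relative interior in the open orthant $\{\phi_iy_i>0\ \forall i\}$ carry the copy of $M(\boldsymbol\phi)S_d(n)$ translated so that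 its centre is $2^{n-1}\boldsymbol\phi$. The patterns $S_d(n)$ stabilise on growing cubes around the origin as $n\to\infty$; the $d$-dimensional paperfolding structure is the limiting pattern, a sign assignment to all faces $F_k(\boldsymbol{x})$, $\boldsymbol{x}\in\mathbb{Z}^d$, $1\le k\le d$. More generally, a $d$-dimensional paperfolding structure is any pattern in the hull of this one (the closure of its translation orbit in the local topology); all of these have the same finite subpatterns up to translation. Cubic subpatterns. The cubic subpattern of linear size $n$ at $\boldsymbol{x}\in\mathbb{Z}^d$ is the collection of signs of the faces $F_k(\boldsymbol{x}+\boldsymbol{z})$, $\boldsymbol{z}\in\{0,\dots,n-1\}^d$, $1\le k\le d$ (i.e. the creases in the semi-cube $\boldsymbol{x}+[0,n)^d$ of side length $n$, including its interior); two such subpatterns are identified if they are translates of each other. *)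

theory Defs
  imports "HOL-Analysis.Analysis"
begin

definition lattice_pts :: "nat \<Rightarrow> (nat \<Rightarrow> int) set" where
  "lattice_pts d = {1..d} \<rightarrow>\<^sub>E UNIV"

text \<open>
  The pair \<open>(k, x)\<close> stands for the unit face
  \<open>F\<^sub>k(x) = {y. y\<^sub>k = x\<^sub>k \<and> (\<forall>i \<noteq> k. x\<^sub>i \<le> y\<^sub>i \<le> x\<^sub>i + 1)}\<close>; distinct pairs give distinct faces.
  Signs are integers: \<open>1\<close> is a valley, \<open>-1\<close> a crest. A crease pattern on some of the
  faces is a partial map, a pattern on all faces is an extensional function on \<open>faces d\<close>.
\<close>

type_synonym face = "nat \<times> (nat \<Rightarrow> int)"

definition faces :: "nat \<Rightarrow> face set" where
  "faces d = {1..d} \<times> lattice_pts d"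

text \<open>
  Faces lying in the cube \<open>[-r, r]\<^sup>d\<close>, but not in its boundary. A face in the cube lies in the
  boundary iff it is contained in one of the hyperplanes \<open>y\<^sub>k = \<plusminus>r\<close>, hence the strict bounds
  on \<open>x\<^sub>k\<close>.
\<close>

definition inner_faces :: "nat \<Rightarrow> int \<Rightarrow> face set" where
  "inner_faces d r =
     {(k, x) \<in> faces d. - r < x k \<and> x k < r \<and> (\<forall>i\<in>{1..d} - {k}. - r \<le> x i \<and> x i + 1 \<le> r)}"

text \<open>
  \<open>reflect i\<close> is the reflection in the hyperplane \<open>y\<^sub>i = 0\<close> acting on faces: for \<open>i \<noteq> k\<close> the
  edge \<open>[x\<^sub>i, x\<^sub>i + 1]\<close> becomes \<open>[- x\<^sub>i - 1, - x\<^sub>i]\<close>.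
\<close>

definition reflect :: "nat \<Rightarrow> face \<Rightarrow> face" where
  "reflect i = (\<lambda>(k, x). (k, x(i := if i = k then - x i else - x i - 1)))"

definition mirror :: "nat \<Rightarrow> (face \<rightharpoonup> int) \<Rightarrow> (face \<rightharpoonup> int)" where
  "mirror i P = (\<lambda>f. map_option uminus (P (reflect i f)))"

text \<open>The \<open>mirror i\<close> commute (see \<open>mirror_commute\<close>), so the order in the product is immaterial.\<close>

definition mirrors :: "nat \<Rightarrow> (nat \<Rightarrow> int) \<Rightarrow> (face \<rightharpoonup> int) \<Rightarrow> (face \<rightharpoonup> int)" where
  "mirrors d \<phi> = foldr mirror (filter (\<lambda>i. \<phi> i = -1) [1..<Suc d])"

definition shift :: "nat \<Rightarrow> (nat \<Rightarrow> int) \<Rightarrow> face \<Rightarrow> face" where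
  "shift d t = (\<lambda>(k, x). (k, \<lambda>i\<in>{1..d}. x i + t i))"

definition side :: "(nat \<Rightarrow> int) \<Rightarrow> nat \<Rightarrow> int" where
  "side x i = (if x i \<ge> 0 then 1 else -1)"

text \<open>
  If \<open>x\<^sub>k \<noteq> 0\<close>, the relative interior of \<open>F\<^sub>k(x)\<close> lies in exactly one open orthant
  \<open>{y. \<forall>i. \<phi>\<^sub>i y\<^sub>i > 0}\<close>, namely the one with \<open>\<phi> = side x\<close>; if \<open>x\<^sub>k = 0\<close> it lies in none.
  All inner faces of \<open>[-1, 1]\<^sup>d\<close> have \<open>x\<^sub>k = 0\<close>, so in the equation for \<open>Suc 0\<close> the truncated
  exponent \<open>0 - 1\<close> plays no role.
\<close>

primrec finite_paperfolding :: "nat \<Rightarrow> nat \<Rightarrow> (face \<rightharpoonup> int)" where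
  "finite_paperfolding d 0 = Map.empty"
| "finite_paperfolding d (Suc n) = (\<lambda>(k, x).
     if (k, x) \<notin> inner_faces d (2 ^ n) then None
     else if x k = 0 then Some (sgn (\<Prod>i\<in>{1..<k}. side x i))
     else mirrors d (side x) (finite_paperfolding d n) (shift d (\<lambda>i. - (2 ^ (n - 1) * side x i)) (k, x)))"

definition paperfolding :: "nat \<Rightarrow> face \<Rightarrow> int" where
  "paperfolding d = (\<lambda>f\<in>faces d. THE s. \<forall>\<^sub>F n in sequentially. finite_paperfolding d n f = Some s)"

definition local_topology :: "nat \<Rightarrow> (face \<Rightarrow> int) topology" where
  "local_topology d = product_topology (\<lambda>_. discrete_topology {1, -1}) (faces d)"

definition translate :: "nat \<Rightarrow> (nat \<Rightarrow> int) \<Rightarrow> (face \<Rightarrow> int) \<Rightarrow> (face \<Rightarrow> int)" where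
  "translate d t P = (\<lambda>f\<in>faces d. P (shift d (\<lambda>i. - t i) f))"

definition pattern_hull :: "nat \<Rightarrow> (face \<Rightarrow> int) \<Rightarrow> (face \<Rightarrow> int) set" where
  "pattern_hull d P = local_topology d closure_of ((\<lambda>t. translate d t P) ` lattice_pts d)"

definition paperfolding_structures :: "nat \<Rightarrow> (face \<Rightarrow> int) set" where
  "paperfolding_structures d = pattern_hull d (paperfolding d)"

text \<open>
  The faces \<open>F\<^sub>k(x + z)\<close> are indexed by \<open>(k, z)\<close>, i.e. relative to the base point \<open>x\<close>, so that
  two subpatterns are equal as functions iff they are translates of each other.
\<close>

definition cubic_subpattern ::
    "nat \<Rightarrow> (face \<Rightarrow> int) \<Rightarrow> nat \<Rightarrow> (nat \<Rightarrow> int) \<Rightarrow> (face \<Rightarrow> int)" where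
  "cubic_subpattern d P n x =
     (\<lambda>f\<in>{1..d} \<times> ({1..d} \<rightarrow>\<^sub>E {0..int n - 1}). P (shift d x f))"

definition cubic_subpatterns :: "nat \<Rightarrow> (face \<Rightarrow> int) \<Rightarrow> nat \<Rightarrow> (face \<Rightarrow> int) set" where
  "cubic_subpatterns d P n = cubic_subpattern d P n ` lattice_pts d"

text \<open>
  The rest of the theory shows that the limit in \<open>paperfolding\<close> exists, so that the
  description operator there, and hence \<open>paperfolding_structures\<close>, is meaningful.
\<close>

declare finite_paperfolding.simps(2) [simp del]

lemma mirror_commute: "mirror i (mirror j P) = mirror j (mirror i P)"
  by (cases "i = j") (auto simp: mirror_def reflect_def fun_upd_twist option.map_comp)

lemma foldr_mirror:
  assumes "distinct is"
  shows "foldr mirror is P (k, x) =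
    map_option (\<lambda>s. (-1) ^ length is * s)
      (P (k, \<lambda>i. if i \<in> set is then (if i = k then - x i else - x i - 1) else x i))"
  using assms
proof (induction "is" arbitrary: x)
  case Nil
  then show ?case by (simp add: option.map_ident)
next
  case (Cons j js)
  have "(\<lambda>i. if i \<in> set js then (if i = k then - (x(j := y)) i else - (x(j := y)) i - 1)
             else (x(j := y)) i) =
        (\<lambda>i. if i = j then y else if i \<in> set js then (if i = k then - x i else - x i - 1) else x i)"
    for y
    using Cons.prems by (auto simp: fun_eq_iff)
  then show ?case
    using Cons by (auto simp: mirror_def reflect_def option.map_comp comp_def fun_eq_iff
        intro!: arg_cong2[where f = map_option] arg_cong[where f = P])
qed

lemma mirrors_eq:
  obtains c :: int where "c \<in> {1, -1}"
    "\<And>P k x. mirrors d \<phi> P (k, x) = map_option (\<lambda>s. c * s)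
      (P (k, \<lambda>i. if i \<in> {1..d} \<and> \<phi> i = -1 then (if i = k then - x i else - x i - 1) else x i))"
proof
  let ?is = "filter (\<lambda>i. \<phi> i = -1) [1..<Suc d]"
  have "(-1::int) ^ n \<in> {1, -1}" for n by (simp add: minus_one_power_iff)
  then show "(-1::int) ^ length ?is \<in> {1, -1}" .
  have s: "i \<in> set ?is \<longleftrightarrow> i \<in> {1..d} \<and> \<phi> i = -1" for i by auto
  show "mirrors d \<phi> P (k, x) = map_option (\<lambda>s. (-1) ^ length ?is * s)
      (P (k, \<lambda>i. if i \<in> {1..d} \<and> \<phi> i = -1 then (if i = k then - x i else - x i - 1) else x i))"
    for P k x
    unfolding mirrors_def by (subst foldr_mirror) (simp, simp only: s)
qed

lemma finite_paperfolding_cong_orthant: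
  assumes "x k \<noteq> 0" "(k, x) \<in> faces d"
  obtains c :: int where "c \<in> {1, -1}"
    "\<And>n. (k, x) \<in> inner_faces d (2 ^ n) \<Longrightarrow> finite_paperfolding d (Suc n) (k, x) =
      map_option (\<lambda>s. c * s) (finite_paperfolding d n (k, \<lambda>i\<in>{1..d}.
        if x i \<ge> 0 then x i - 2 ^ (n - 1)
        else if i = k then - x i - 2 ^ (n - 1) else - x i - 2 ^ (n - 1) - 1))"
proof -
  obtain c :: int where c: "c \<in> {1, -1}"
    "\<And>P k y. mirrors d (side x) P (k, y) = map_option (\<lambda>s. c * s)
      (P (k, \<lambda>i. if i \<in> {1..d} \<and> side x i = -1 then (if i = k then - y i else - y i - 1) else y i))"
    using mirrors_eq[of d "side x"] by blast
  show ?thesis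
  proof (rule that[OF c(1)])
    fix n assume "(k, x) \<in> inner_faces d (2 ^ n)"
    then show "finite_paperfolding d (Suc n) (k, x) =
      map_option (\<lambda>s. c * s) (finite_paperfolding d n (k, \<lambda>i\<in>{1..d}.
        if x i \<ge> 0 then x i - 2 ^ (n - 1)
        else if i = k then - x i - 2 ^ (n - 1) else - x i - 2 ^ (n - 1) - 1))"
      using assms(1) by (auto simp: finite_paperfolding.simps(2) shift_def c(2) side_def
          intro!: arg_cong2[where f = map_option] arg_cong[where f = "finite_paperfolding d n"] ext)
  qed
qed

lemma finite_paperfolding_sign:
  assumes "f \<in> inner_faces d (2 ^ n)"
  shows "\<exists>s\<in>{1, -1}. finite_paperfolding d (Suc n) f = Some s"
  using assms
proof (induction n arbitrary: f)
  have side_prod: "sgn (\<Prod>i\<in>{1..<k}. side x i) \<in> {1, -1}" for k x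
    by (simp add: sgn_if side_def)
  {
    case 0
    obtain k x where f: "f = (k, x)" by (cases f)
    with 0 have "x k = 0" by (auto simp: inner_faces_def)
    then show ?case using 0 f side_prod by (auto simp: finite_paperfolding.simps(2))
  next
    case (Suc n)
    obtain k x where f: "f = (k, x)" by (cases f)
    show ?case
    proof (cases "x k = 0")
      case True
      then show ?thesis using Suc.prems f side_prod by (auto simp: finite_paperfolding.simps(2))
    next
      case False
      have fx: "(k, x) \<in> faces d" using Suc.prems f by (auto simp: inner_faces_def)
      obtain c :: int where c: "c \<in> {1, -1}"
        "\<And>n. (k, x) \<in> inner_faces d (2 ^ n) \<Longrightarrow> finite_paperfolding d (Suc n) (k, x) =
        map_option (\<lambda>s. c * s) (finite_paperfolding d n (k, \<lambda>i\<in>{1..d}.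
          if x i \<ge> 0 then x i - 2 ^ (n - 1)
          else if i = k then - x i - 2 ^ (n - 1) else - x i - 2 ^ (n - 1) - 1))"
        using finite_paperfolding_cong_orthant[of x k, OF False fx] by blast
      let ?y = "\<lambda>i\<in>{1..d}. if x i \<ge> 0 then x i - 2 ^ n
          else if i = k then - x i - 2 ^ n else - x i - 2 ^ n - 1"
      have "(k, ?y) \<in> inner_faces d (2 ^ n)"
        using Suc.prems f False by (force simp: inner_faces_def faces_def lattice_pts_def)
      then obtain s where "s \<in> {1, -1}" "finite_paperfolding d (Suc n) (k, ?y) = Some s"
        using Suc.IH by blast
      moreover have "finite_paperfolding d (Suc (Suc n)) f =
          map_option (\<lambda>s. c * s) (finite_paperfolding d (Suc n) (k, ?y))"
        using c(2)[of "Suc n"] Suc.prems unfolding f diff_Suc_1 by blast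
      ultimately show ?thesis using c(1) by auto
    qed
  }
qed

lemma finite_paperfolding_corner:
  assumes "(k, x) \<in> faces d" "\<And>i. i \<in> {1..d} \<Longrightarrow> x i < 2 ^ m" "\<And>i. i \<in> {1..d} \<Longrightarrow> x i \<ge> 0" "x k > 0"
    and "n \<ge> Suc m"
  shows "finite_paperfolding d n (k, \<lambda>i\<in>{1..d}. if i = k then 2 ^ (n - 1) - x i else 2 ^ (n - 1) - 1 - x i) =
    finite_paperfolding d (Suc m) (k, \<lambda>i\<in>{1..d}. if i = k then 2 ^ m - x i else 2 ^ m - 1 - x i)"
  using assms(5)
proof (induction n rule: dec_induct)
  case base
  then show ?case unfolding diff_Suc_1 by (rule refl)
next
  case (step n)
  then obtain p where n: "n = Suc p" by (cases n) auto
  define w where "w = (\<lambda>i\<in>{1..d}. if i = k then 2 ^ n - x i else 2 ^ n - 1 - x i)"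
  have k: "k \<in> {1..d}" using assms(1) by (auto simp: faces_def)
  have "(2::int) ^ m \<le> 2 ^ n" using step.hyps by (intro power_increasing) auto
  then have lt: "x i < 2 ^ n" if "i \<in> {1..d}" for i using assms(2)[OF that] by linarith
  then have y: "w k \<noteq> 0" "\<And>i. i \<in> {1..d} \<Longrightarrow> w i \<ge> 0" using k by (force simp: w_def)+
  have in_y: "(k, w) \<in> inner_faces d (2 ^ n)"
    using lt assms(1,3,4) k y(2) by (force simp: w_def inner_faces_def faces_def lattice_pts_def)
  have s: "side w i = 1" if "i \<in> {1..d}" for i using y(2)[OF that] unfolding side_def by simp
  have "filter (\<lambda>i. side w i = -1) [1..<Suc d] = []"
    using s by (auto simp: filter_empty_conv)
  then have m: "mirrors d (side w) = (\<lambda>P. P)" unfolding mirrors_def by auto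
  have "finite_paperfolding d (Suc n) (k, w) =
      finite_paperfolding d n (shift d (\<lambda>i. - (2 ^ (n - 1) * side w i)) (k, w))"
    using in_y y(1) by (simp only: finite_paperfolding.simps prod.case m if_False not_not simp_thms)
  also have "shift d (\<lambda>i. - (2 ^ (n - 1) * side w i)) (k, w) =
      (k, \<lambda>i\<in>{1..d}. if i = k then 2 ^ (n - 1) - x i else 2 ^ (n - 1) - 1 - x i)"
    unfolding shift_def prod.case by (intro arg_cong2[where f = Pair] refl restrict_ext)
      (simp add: s, simp add: w_def n)
  finally show ?case using step.IH unfolding w_def diff_Suc_1 by (rule trans)
qed

lemma finite_paperfolding_stabilises:
  assumes "f \<in> faces d"
  shows "\<exists>s\<in>{1, -1}. \<forall>\<^sub>F n in sequentially. finite_paperfolding d n f = Some s"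
proof -
  obtain k x where f: "f = (k, x)" by (cases f)
  have k: "k \<in> {1..d}" using assms f by (auto simp: faces_def)
  define b where "b = Max ((\<lambda>i. \<bar>x i\<bar>) ` {1..d}) + 1"
  have b: "\<bar>x i\<bar> < b" if "i \<in> {1..d}" for i
    using that by (auto simp: b_def zle_add1_eq_le intro!: Max_ge)
  define m where "m = nat b"
  have "int (nat b) < int (2 ^ m)" unfolding m_def using less_exp of_nat_less_iff by blast
  moreover have "int (2 ^ m) = 2 ^ m" by simp
  ultimately have "b \<le> 2 ^ m" using int_nat_eq[of b] by linarith
  then have bnd: "\<bar>x i\<bar> < 2 ^ m" if "i \<in> {1..d}" for i using b[OF that] by linarith
  have inner: "f \<in> inner_faces d (2 ^ n)" if "n \<ge> m" for n
  proof -
    have "(2::int) ^ m \<le> 2 ^ n" using that by (intro power_increasing) auto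
    then have "\<bar>x i\<bar> < 2 ^ n" if "i \<in> {1..d}" for i using bnd[OF that] by linarith
    then have "- (2 ^ n) \<le> x i" "x i + 1 \<le> 2 ^ n" "- (2 ^ n) < x i" "x i < 2 ^ n"
      if "i \<in> {1..d}" for i using that by fastforce+
    then show ?thesis using assms f k by (auto simp: inner_faces_def)
  qed
  have "\<exists>s. \<forall>\<^sub>F n in sequentially. finite_paperfolding d n f = s"
  proof (cases "x k = 0")
    case True
    have "finite_paperfolding d n f = Some (sgn (\<Prod>i\<in>{1..<k}. side x i))" if "n \<ge> Suc m" for n
      using that inner[of "n - 1"] True f by (cases n) (auto simp: finite_paperfolding.simps(2))
    then show ?thesis by (intro exI eventually_sequentiallyI)
  next
    case False
    obtain c :: int where c: "c \<in> {1, -1}"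
      "\<And>n. (k, x) \<in> inner_faces d (2 ^ n) \<Longrightarrow> finite_paperfolding d (Suc n) (k, x) =
        map_option (\<lambda>s. c * s) (finite_paperfolding d n (k, \<lambda>i\<in>{1..d}.
          if x i \<ge> 0 then x i - 2 ^ (n - 1)
          else if i = k then - x i - 2 ^ (n - 1) else - x i - 2 ^ (n - 1) - 1))"
      using finite_paperfolding_cong_orthant[of x k, OF False] assms f by blast
    define y where "y = (\<lambda>n. \<lambda>i\<in>{1..d}. if x i \<ge> 0 then x i - 2 ^ n
          else if i = k then - x i - 2 ^ n else - x i - 2 ^ n - (1::int))"
    define z where "z = (\<lambda>i\<in>{1..d}. if i = k then \<bar>x i\<bar> else if x i \<ge> 0 then x i else - x i - 1)"
    have z: "(k, z) \<in> faces d" "z k > 0"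
      using k False by (auto simp: z_def faces_def lattice_pts_def)
    have z': "z i < 2 ^ m" "z i \<ge> 0" if "i \<in> {1..d}" for i
      using that bnd[OF that] by (auto simp: z_def)
    define t where "t = finite_paperfolding d (Suc m)
        (k, \<lambda>i\<in>{1..d}. if i = k then 2 ^ m - z i else 2 ^ m - 1 - z i)"
    have yn: "y n i < 0" "\<bar>y n i\<bar> \<le> 2 ^ n" "i = k \<Longrightarrow> \<bar>y n i\<bar> < 2 ^ n"
      "y n i = z i - 2 ^ n" if "n \<ge> m" "i \<in> {1..d}" for n i
    proof -
      have "(2::int) ^ m \<le> 2 ^ n" using that by (intro power_increasing) auto
      then have "\<bar>x i\<bar> < 2 ^ n" using bnd[OF that(2)] by linarith
      then show "y n i < 0" "\<bar>y n i\<bar> \<le> 2 ^ n" "i = k \<Longrightarrow> \<bar>y n i\<bar> < 2 ^ n"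
        "y n i = z i - 2 ^ n"
        using that(2) False by (auto simp: y_def z_def)
    qed
    have yf: "(k, y n) \<in> faces d" for n using k by (auto simp: y_def faces_def lattice_pts_def)
    have inner_y: "(k, y n) \<in> inner_faces d (2 ^ n)" if "n \<ge> m" for n
    proof -
      have "- (2 ^ n) \<le> y n i" "y n i + 1 \<le> 2 ^ n" if i: "i \<in> {1..d}" for i
        using yn(1,2)[OF \<open>n \<ge> m\<close> i] by linarith+
      moreover have "- (2 ^ n) < y n k" "y n k < 2 ^ n"
        using yn(1,3)[OF \<open>n \<ge> m\<close> k] by linarith+
      ultimately show ?thesis using yf[of n] by (simp add: inner_faces_def)
    qed
    have side_y: "side (y n) i = -1" if "n \<ge> m" "i \<in> {1..d}" for n i
      using yn(1)[OF that] by (simp add: side_def)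
    have m_side: "mirrors d (side (y n)) = mirrors d (\<lambda>_. -1)" if "n \<ge> m" for n
    proof -
      have "filter (\<lambda>i. side (y n) i = -1) [1..<Suc d] = filter (\<lambda>i. (-1::int) = -1) [1..<Suc d]"
        using yn(1)[OF that] by (intro filter_cong) (auto simp: side_def not_le)
      then show ?thesis by (simp add: mirrors_def)
    qed
    obtain e :: int where e: "e \<in> {1, -1}" "\<And>P k x. mirrors d (\<lambda>_. -1) P (k, x) = map_option (\<lambda>s. e * s)
      (P (k, \<lambda>i. if i \<in> {1..d} \<and> (-1::int) = -1 then (if i = k then - x i else - x i - 1) else x i))"
      using mirrors_eq[of d "\<lambda>_. -1"] by blast
    have stable:
      "finite_paperfolding d (Suc (Suc n)) f = map_option (\<lambda>s. c * s) (map_option (\<lambda>s. e * s) t)"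
      if "n \<ge> Suc m" for n
    proof -
      obtain p where p: "n = Suc p" using Suc_le_D[of m n] \<open>n \<ge> Suc m\<close> by blast
      have nm: "n \<ge> m" using that by simp
      have corner: "finite_paperfolding d n (k, \<lambda>i\<in>{1..d}.
          if i = k then 2 ^ (n - 1) - z i else 2 ^ (n - 1) - 1 - z i) = t"
        unfolding t_def
      proof (rule finite_paperfolding_corner[where k = k and x = z and d = d and m = m and n = n])
        show "(k, z) \<in> faces d" by (rule z(1))
        show "z k > 0" by (rule z(2))
        show "z i < 2 ^ m" if "i \<in> {1..d}" for i using that by (rule z'(1))
        show "z i \<ge> 0" if "i \<in> {1..d}" for i using that by (rule z'(2))
        show "n \<ge> Suc m" using \<open>n \<ge> Suc m\<close> .
      qed
      have "finite_paperfolding d (Suc (Suc n)) f =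
          map_option (\<lambda>s. c * s) (finite_paperfolding d (Suc n) (k, y n))"
        using c(2)[of "Suc n"] inner[of "Suc n"] nm unfolding f y_def diff_Suc_1 by force
      also have "finite_paperfolding d (Suc n) (k, y n) =
          mirrors d (side (y n)) (finite_paperfolding d n)
            (shift d (\<lambda>i. - (2 ^ (n - 1) * side (y n) i)) (k, y n))"
        using inner_y[OF nm] yn(1)[OF nm k] by (simp add: finite_paperfolding.simps(2))
      also have "\<dots> = map_option (\<lambda>s. e * s) (finite_paperfolding d n
          (k, \<lambda>i\<in>{1..d}. if i = k then 2 ^ (n - 1) - z i else 2 ^ (n - 1) - 1 - z i))"
        unfolding m_side[OF nm] shift_def prod.case e(2)
        using yn(4)[OF nm] side_y[OF nm]
        by (intro arg_cong2[where f = map_option] arg_cong[where f = "finite_paperfolding d n"]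
            arg_cong2[where f = Pair] refl ext) (auto simp: p)
      also have "\<dots> = map_option (\<lambda>s. e * s) t"
        by (simp only: corner)
      finally show ?thesis .
    qed
    have "finite_paperfolding d n f = map_option (\<lambda>s. c * s) (map_option (\<lambda>s. e * s) t)"
      if "n \<ge> Suc (Suc (Suc m))" for n
    proof -
      have e2: "Suc (Suc (n - 2)) = n" and "n - 2 \<ge> Suc m" using that by linarith+
      from stable[OF this(2)] show ?thesis unfolding e2 .
    qed
    then have "\<forall>\<^sub>F n in sequentially. finite_paperfolding d n f =
        map_option (\<lambda>s. c * s) (map_option (\<lambda>s. e * s) t)"
      by (rule eventually_sequentiallyI)
    then show ?thesis by (rule exI)
  qed
  then obtain s where s: "\<forall>\<^sub>F n in sequentially. finite_paperfolding d n f = s" by blast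
  then obtain N where N: "\<And>n. n \<ge> N \<Longrightarrow> finite_paperfolding d n f = s"
    unfolding eventually_sequentially by blast
  obtain u where "u \<in> {1, -1}" "finite_paperfolding d (Suc (max N m)) f = Some u"
    using finite_paperfolding_sign[OF inner[of "max N m"]] by auto
  moreover have "finite_paperfolding d (Suc (max N m)) f = s" by (rule N) simp
  ultimately show ?thesis using s by auto
qed

lemma paperfolding_limit:
  assumes "f \<in> faces d"
  shows "\<forall>\<^sub>F n in sequentially. finite_paperfolding d n f = Some (paperfolding d f)"
    and "paperfolding d f \<in> {1, -1}"
proof -
  obtain s where s: "s \<in> {1, -1}" "\<forall>\<^sub>F n in sequentially. finite_paperfolding d n f = Some s"
    using finite_paperfolding_stabilises[OF assms] by blast
  have "(THE s. \<forall>\<^sub>F n in sequentially. finite_paperfolding d n f = Some s) = s"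
  proof (rule the_equality, rule s(2))
    fix t assume "\<forall>\<^sub>F n in sequentially. finite_paperfolding d n f = Some t"
    with s(2) have "\<forall>\<^sub>F n in sequentially. (s::int) = t" by eventually_elim simp
    then show "t = s" by simp
  qed
  then have "paperfolding d f = s" using assms by (simp add: paperfolding_def)
  with s show "\<forall>\<^sub>F n in sequentially. finite_paperfolding d n f = Some (paperfolding d f)"
    and "paperfolding d f \<in> {1, -1}" by auto
qed

lemma paperfolding_in_structures: "paperfolding d \<in> paperfolding_structures d"
proof -
  have "translate d (\<lambda>i\<in>{1..d}. 0) (paperfolding d) = paperfolding d"
  proof
    fix f show "translate d (\<lambda>i\<in>{1..d}. 0) (paperfolding d) f = paperfolding d f"
    proof (cases "f \<in> faces d")
      case True
      then have "shift d (\<lambda>i. - (\<lambda>i\<in>{1..d}. 0) i) f = f"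
        by (auto simp: shift_def faces_def lattice_pts_def fun_eq_iff PiE_def extensional_def)
      then show ?thesis using True by (simp add: translate_def)
    qed (auto simp: translate_def paperfolding_def)
  qed
  moreover have "(\<lambda>i\<in>{1..d}. 0) \<in> lattice_pts d" by (auto simp: lattice_pts_def)
  ultimately have orbit: "paperfolding d \<in> (\<lambda>t. translate d t (paperfolding d)) ` lattice_pts d"
    by (metis imageI)
  have "paperfolding d \<in> topspace (local_topology d)"
    using paperfolding_limit(2) by (auto simp: local_topology_def paperfolding_def PiE_iff)
  with orbit show ?thesis
    unfolding paperfolding_structures_def pattern_hull_def
    by (intro subsetD[OF closure_of_subset_Int] IntI)
qed

end

theory Submission
  imports Defs
begin

text \<open>
  The recursion defining the paperfolding structure can be solved in closed form. Shift the
  origin of the stage \<open>S\<^sub>d(n + 1)\<close>, which fills the cube \<open>[-2\<^sup>n, 2\<^sup>n]\<^sup>d\<close>, to the corner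
  \<open>(2\<^sup>n, ..., 2\<^sup>n)\<close> and write every coordinate in binary. A face perpendicular to axis \<open>k\<close> whose \<open>k\<close>-th coordinate is exactly divisible by
  \<open>2\<^sup>v\<close> lies in the central hyperplane of a unique dyadic cube \<open>Q\<close> of side \<open>2\<^sup>v\<^sup>+\<^sup>1\<close>. Bit \<open>v\<close> of
  coordinate \<open>i\<close> tells in which half of \<open>Q\<close> the face lies, bit \<open>v + 1\<close> tells in which half of its
  parent cube \<open>Q\<close> lies. The reflections accumulated on the way down to \<open>Q\<close> collapse to the last
  one, since the reflections of a parent also decide which of its children is reflected, and
  reflecting twice cancels. Hence the sign of the face is the product of the bits \<open>v\<close> of the
  coordinates \<open>i < k\<close> and the bits \<open>v + 1\<close> of the coordinates \<open>i \<ge> k\<close>, bits being read as signs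
  (lemma \<open>finite_paperfolding_eq_crease_sign\<close>).

  Now let \<open>n \<le> 2\<^sup>m\<close> and look at a window of side \<open>n\<close> at \<open>y\<close>. Faces with \<open>v < m\<close> read only
  bits below \<open>m + 1\<close>, so their signs are determined by \<open>y\<close> modulo \<open>2\<^sup>m\<^sup>+\<^sup>1\<close>. For every axis \<open>k\<close>
  the window contains at most one multiple of \<open>2\<^sup>m\<close>, so the faces with \<open>v \<ge> m\<close> that are
  perpendicular to axis \<open>k\<close> all lie in one hyperplane and share the same \<open>v\<close>. The bits they read
  have index at least \<open>m\<close>, and along a window such a bit of coordinate \<open>i\<close> takes one value before
  the multiple of \<open>2\<^sup>m\<close> and one value after it. So two bits for each pair \<open>(k, i)\<close> determine
  everything else (lemma \<open>crease_window_determined\<close>), and the number of windows is at most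
  \<open>(2\<^sup>m\<^sup>+\<^sup>1)\<^sup>d \<cdot> 2\<^bsup>2d\<^sup>2\<^esup>\<close>, where \<open>m\<close> can be chosen with \<open>2\<^sup>m \<le> 2n\<close>.

  A window of a pattern in the hull is a window of the paperfolding structure, because
  the window is finite, and a window of the paperfolding structure is a window of a finite stage.
\<close>

section \<open>Binary digits of integers\<close>

lemma bit_cong_mod_power:
  fixes a b :: int
  assumes "a mod 2 ^ N = b mod 2 ^ N" "j < N"
  shows "bit a j \<longleftrightarrow> bit b j"
  using assms by (metis bit_take_bit_iff take_bit_eq_mod)

lemma le_multiplicity_2_iff:
  fixes a :: int
  assumes "a \<noteq> 0"
  shows "n \<le> multiplicity 2 a \<longleftrightarrow> 2 ^ n dvd a"
  using assms by (intro power_dvd_iff_le_multiplicity[symmetric]) auto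

lemma multiplicity_2_cong:
  fixes a b :: int
  assumes "a mod 2 ^ N = b mod 2 ^ N" "\<not> 2 ^ N dvd a"
  shows "multiplicity 2 a = multiplicity 2 b" "multiplicity 2 a < N"
proof -
  have nz: "a \<noteq> 0" "b \<noteq> 0" and b: "\<not> 2 ^ N dvd b"
    using assms by (auto simp: dvd_eq_mod_eq_0)
  show lt: "multiplicity 2 a < N"
    using assms(2) le_multiplicity_2_iff[OF nz(1)] not_le by blast
  have lt': "multiplicity 2 b < N"
    using b le_multiplicity_2_iff[OF nz(2)] not_le by blast
  have "(2::int) ^ n dvd a \<longleftrightarrow> 2 ^ n dvd b" if "n \<le> N" for n
  proof -
    have "(2::int) ^ n dvd 2 ^ N" using that by (rule le_imp_power_dvd)
    moreover have "2 ^ N dvd a - b" using assms(1) by (simp add: mod_eq_dvd_iff)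
    ultimately have "2 ^ n dvd a - b" by (rule dvd_trans)
    then show ?thesis by (metis dvd_diff_commute dvd_diff_right_iff diff_add_cancel dvd_add_right_iff)
  qed
  then have "n \<le> multiplicity 2 a \<longleftrightarrow> n \<le> multiplicity 2 b" if "n \<le> N" for n
    using that nz le_multiplicity_2_iff by blast
  then show "multiplicity 2 a = multiplicity 2 b"
    using lt lt' by (meson le_antisym less_imp_le order_refl)
qed

text \<open>
  Negating \<open>2\<^sup>v u\<close> with \<open>u\<close> odd preserves the lowest set digit \<open>v\<close> and flips all digits above it.
  The sign of a face depends on its perpendicular coordinate only through the digit \<open>v + 1\<close>.
\<close>

lemma bit_above_lowest_uminus:
  fixes a :: int
  assumes "a \<noteq> 0"
  shows "bit (- a) (Suc (multiplicity 2 a)) \<longleftrightarrow> \<not> bit a (Suc (multiplicity 2 a))"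
proof -
  obtain u where u: "a = 2 ^ multiplicity 2 a * u" "\<not> 2 dvd u"
    using multiplicity_decompose'[of a 2] assms by auto
  obtain w where w: "u = 2 * w + 1" using u(2) by (elim oddE)
  have b: "bit (2 ^ v * (2 * w + 1)) (Suc v) \<longleftrightarrow> odd w" for v and w :: int
    by (simp add: bit_iff_odd power_Suc2 div_mult2_eq del: power_Suc)
  have "- a = 2 ^ multiplicity 2 a * (2 * (- w - 1) + 1)"
    using u(1) w by (simp add: algebra_simps)
  then have "bit (- a) (Suc (multiplicity 2 a)) \<longleftrightarrow> odd (- w - 1)"
    by (metis b)
  moreover have "bit a (Suc (multiplicity 2 a)) \<longleftrightarrow> odd w"
    using b[of "multiplicity 2 a" w] u(1) w by metis
  ultimately show ?thesis by simp
qed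

section \<open>The closed form\<close>

definition bit_sign :: "int \<Rightarrow> nat \<Rightarrow> int" where
  "bit_sign a j = (if bit a j then 1 else -1)"

text \<open>
  The closed form for the sign of the face \<open>(k, q)\<close>. The origin is at the positive corner of the
  cube, so the entries of \<open>q\<close> are negative and their digits are those of the two's complement
  expansion.
\<close>

definition crease_sign :: "nat \<Rightarrow> nat \<Rightarrow> (nat \<Rightarrow> int) \<Rightarrow> int" where
  "crease_sign d k q = (\<Prod>i\<in>{1..d}. bit_sign (q i)
     (if i < k then multiplicity 2 (q k) else Suc (multiplicity 2 (q k))))"

lemma prod_side_eq:
  "(-1) ^ length (filter (\<lambda>i. side x i = -1) [1..<Suc d]) = (\<Prod>i\<in>{1..d}. side x i)"
proof -
  have "length (filter (\<lambda>i. side x i = -1) [1..<Suc d]) = card (set (filter (\<lambda>i. side x i = -1) [1..<Suc d]))"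
    by (intro distinct_card[symmetric] distinct_filter distinct_upt)
  also have "set (filter (\<lambda>i. side x i = -1) [1..<Suc d]) = {i \<in> {1..d}. x i < 0}"
    by (auto simp: side_def split: if_splits)
  finally have len: "length (filter (\<lambda>i. side x i = -1) [1..<Suc d]) = card {i \<in> {1..d}. x i < 0}" .
  have "(\<Prod>i\<in>{1..d}. side x i) = (\<Prod>i\<in>{1..d}. if x i < 0 then -1 else 1)"
    by (intro prod.cong) (auto simp: side_def)
  also have "\<dots> = (\<Prod>i\<in>{i \<in> {1..d}. x i < 0}. -1)"
    by (subst prod.inter_filter) auto
  finally show ?thesis by (simp only: len prod_constant)
qed

text \<open>
  Subtracting \<open>2\<^sup>n\<close> moves the cube \<open>[-2\<^sup>n, 2\<^sup>n]\<^sup>d\<close> to \<open>[-2\<^sup>n\<^sup>+\<^sup>1, 0]\<^sup>d\<close>. The face is in the central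
  hyperplane, so \<open>v = n\<close>; all coordinates being negative, their digits \<open>n + 1\<close> are ones,
  which removes the factors with \<open>i \<ge> k\<close>. With the other corner as the origin these digits would be
  zeros and would contribute unwanted signs.
\<close>

lemma crease_sign_central:
  assumes "(k, x) \<in> inner_faces d (2 ^ n)" "x k = 0"
  shows "crease_sign d k (\<lambda>i. x i - 2 ^ n) = sgn (\<Prod>i\<in>{1..<k}. side x i)"
proof -
  have k: "k \<in> {1..d}" using assms by (auto simp: inner_faces_def faces_def)
  have bounds: "- (2 ^ n) \<le> x i" "x i < 2 ^ n" if "i \<in> {1..d}" for i
    using assms that by (cases "i = k"; force simp: inner_faces_def)+
  have v: "multiplicity 2 (x k - 2 ^ n) = n"
    using assms(2) multiplicity_times_unit_right[of "-1" 2 "2 ^ n :: int"]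
    by (simp add: multiplicity_same_power)
  have b1: "bit_sign (x i - 2 ^ n) n = side x i" if "i \<in> {1..d}" for i
  proof (cases "x i \<ge> 0")
    case True
    then have "(x i - 2 ^ n) div 2 ^ n = -1"
      using bounds[OF that] by (intro int_div_pos_eq[where r = "x i"]) auto
    then show ?thesis using True by (simp add: bit_sign_def bit_iff_odd side_def)
  next
    case False
    then have "(x i - 2 ^ n) div 2 ^ n = -2"
      using bounds[OF that] by (intro int_div_pos_eq[where r = "x i + 2 ^ n"]) auto
    then show ?thesis using False by (simp add: bit_sign_def bit_iff_odd side_def)
  qed
  have b2: "bit_sign (x i - 2 ^ n) (Suc n) = 1" if "i \<in> {1..d}" for i
  proof -
    have "(x i - 2 ^ n) div 2 ^ Suc n = -1"
      using bounds[OF that] by (intro int_div_pos_eq[where r = "x i + 2 ^ n"]) auto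
    then show ?thesis unfolding bit_sign_def bit_iff_odd by simp
  qed
  have "(\<Prod>i\<in>{1..<k}. side x i) = crease_sign d k (\<lambda>i. x i - 2 ^ n)"
    unfolding crease_sign_def v
    using k by (intro prod.mono_neutral_cong_left) (auto simp: b1 b2)
  moreover have "sgn (\<Prod>i\<in>{1..<k}. side x i) = (\<Prod>i\<in>{1..<k}. side x i)"
  proof -
    have "(\<Prod>i\<in>I. side x i) \<in> {1, -1}" if "finite I" for I
      using that by induction (auto simp: side_def)
    moreover have "sgn p = p" if "p \<in> {1, -1}" for p :: int using that by auto
    ultimately show ?thesis by blast
  qed
  ultimately show ?thesis by simp
qed

text \<open>
  The image of the face \<open>(k, x)\<close> in the positive orthant under the reflections in the coordinate
  hyperplanes.
\<close>

definition fold_coord :: "nat \<Rightarrow> (nat \<Rightarrow> int) \<Rightarrow> nat \<Rightarrow> int" where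
  "fold_coord k x i = (if side x i = -1 then (if i = k then - x i else - x i - 1) else x i)"

text \<open>
  This is the self-similarity of the closed form that matches the recursion: reflecting in one
  coordinate hyperplane changes the sign. For \<open>i \<noteq> k\<close> the reflection sends \<open>x\<^sub>i\<close> to \<open>- x\<^sub>i - 1\<close>, which
  complements all digits; for \<open>i = k\<close> it sends \<open>x\<^sub>k\<close> to \<open>- x\<^sub>k\<close>, which complements the digit just
  above the lowest set one. Every coordinate contributes exactly one digit to the product, so each
  reflection flips exactly one factor.
\<close>

lemma crease_sign_reflect:
  assumes "x k \<noteq> 0" "\<bar>x k\<bar> < 2 ^ N" "k \<in> {1..d}"
  shows "crease_sign d k (\<lambda>i. x i - 2 ^ N) =
    (\<Prod>i\<in>{1..d}. side x i) * crease_sign d k (\<lambda>i. fold_coord k x i - 2 ^ N)"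
proof -
  define v where "v = multiplicity 2 (x k)"
  have "\<not> 2 ^ N dvd x k" using assms(1,2) zdvd_imp_le[of "2 ^ N" "\<bar>x k\<bar>"] by auto
  then have v: "v < N" and vx: "multiplicity 2 (x k - 2 ^ N) = v"
    using multiplicity_2_cong[of "x k" N "x k - 2 ^ N"] by (auto simp: v_def)
  have vm: "multiplicity 2 (- x k) = v"
    unfolding v_def using multiplicity_times_unit_right[of "-1" 2 "x k"] by simp
  have vy: "multiplicity 2 (fold_coord k x k - 2 ^ N) = v"
  proof (cases "x k \<ge> 0")
    case True
    then show ?thesis using vx by (simp add: fold_coord_def side_def)
  next
    case False
    then show ?thesis
      using multiplicity_2_cong(1)[of "- x k" N "- x k - 2 ^ N"] vm \<open>\<not> 2 ^ N dvd x k\<close>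
      by (simp add: fold_coord_def side_def)
  qed
  have factor: "bit_sign (x i - 2 ^ N) (if i < k then v else Suc v) =
      side x i * bit_sign (fold_coord k x i - 2 ^ N) (if i < k then v else Suc v)"
    if i: "i \<in> {1..d}" for i
  proof (cases "x i \<ge> 0")
    case True
    then show ?thesis by (simp add: fold_coord_def side_def)
  next
    case neg: False
    define j where "j = (if i < k then v else Suc v)"
    have j: "j < Suc N" using v by (auto simp: j_def)
    \<comment> \<open>The reflection moves one end of the cube to the other, which alters the coordinates by a
       multiple of \<open>2 ^ Suc N\<close>; this is beyond the digits in use.\<close>
    have wrap: "(- (a - 2 ^ N)) mod 2 ^ Suc N = (- a - 2 ^ N) mod 2 ^ Suc N"
      "(- (a - 2 ^ N) - 1) mod 2 ^ Suc N = (- a - 1 - 2 ^ N) mod 2 ^ Suc N" for a :: int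
      by (simp_all add: mod_eq_dvd_iff)
    have "bit (fold_coord k x i - 2 ^ N) j \<longleftrightarrow> \<not> bit (x i - 2 ^ N) j"
    proof (cases "i = k")
      case True
      have nz: "x k - 2 ^ N \<noteq> 0" using assms(2) by auto
      have "bit (fold_coord k x i - 2 ^ N) j \<longleftrightarrow> bit (- (x i - 2 ^ N)) j"
        using True neg bit_cong_mod_power[OF wrap(1) j] by (simp add: fold_coord_def side_def)
      also have "\<dots> \<longleftrightarrow> \<not> bit (x i - 2 ^ N) j"
        using bit_above_lowest_uminus[OF nz] unfolding vx by (simp add: True j_def)
      finally show ?thesis .
    next
      case False
      then have "bit (fold_coord k x i - 2 ^ N) j \<longleftrightarrow> bit (- (x i - 2 ^ N) - 1) j"
        using neg bit_cong_mod_power[OF wrap(2) j] by (simp add: fold_coord_def side_def)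
      then show ?thesis by (simp only: bit_not_int_iff')
    qed
    then show ?thesis using neg unfolding j_def[symmetric] by (simp add: bit_sign_def side_def)
  qed
  show ?thesis
    unfolding crease_sign_def vx vy prod.distrib[symmetric]
    by (intro prod.cong refl factor)
qed

lemma crease_sign_cong:
  assumes "k \<in> {1..d}" "\<And>i. i \<in> {1..d} \<Longrightarrow> q i = q' i"
  shows "crease_sign d k q = crease_sign d k q'"
  unfolding crease_sign_def using assms by (intro prod.cong) auto

lemma finite_paperfolding_domain:
  assumes "finite_paperfolding d (Suc n) (k, x) = Some s"
  shows "(k, x) \<in> inner_faces d (2 ^ n)"
  using assms by (subst (asm) finite_paperfolding.simps(2)) (auto split: if_splits)

lemma finite_paperfolding_eq_crease_sign:
  assumes "finite_paperfolding d (Suc n) (k, x) = Some s"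
  shows "s = crease_sign d k (\<lambda>i. x i - 2 ^ n)"
  using assms
proof (induction n arbitrary: x s)
  case 0
  then have "(k, x) \<in> inner_faces d (2 ^ 0)" by (rule finite_paperfolding_domain)
  moreover from this have "x k = 0" by (auto simp: inner_faces_def)
  ultimately show ?case
    using 0 crease_sign_central[of k x d 0] by (auto simp: finite_paperfolding.simps(2))
next
  case (Suc n)
  have inner: "(k, x) \<in> inner_faces d (2 ^ Suc n)"
    using Suc.prems by (rule finite_paperfolding_domain)
  then have k: "k \<in> {1..d}" by (auto simp: inner_faces_def faces_def)
  show ?case
  proof (cases "x k = 0")
    case True
    then show ?thesis
      using Suc.prems inner crease_sign_central[OF inner True]
      by (subst (asm) finite_paperfolding.simps(2)) auto
  next
    case False
    \<comment> \<open>\<open>z\<close> is the position, in the stage before, of the face whose sign is copied to \<open>x\<close>.\<close>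
    define y where "y = (\<lambda>i\<in>{1..d}. x i - 2 ^ n * side x i)"
    define L where "L = filter (\<lambda>i. side x i = -1) [1..<Suc d]"
    define z where "z = (\<lambda>i. if i \<in> set L then (if i = k then - y i else - y i - 1) else y i)"
    have "finite_paperfolding d (Suc (Suc n)) (k, x) =
        mirrors d (side x) (finite_paperfolding d (Suc n)) (k, y)"
      using inner False by (subst finite_paperfolding.simps(2)) (simp add: shift_def y_def)
    also have "\<dots> = map_option (\<lambda>s. (-1) ^ length L * s) (finite_paperfolding d (Suc n) (k, z))"
      unfolding mirrors_def L_def[symmetric] z_def by (intro foldr_mirror) (simp add: L_def)
    finally obtain t where t: "finite_paperfolding d (Suc n) (k, z) = Some t"
        "s = (-1) ^ length L * t"
      unfolding Suc.prems by (metis map_option_eq_Some)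
    have "t = crease_sign d k (\<lambda>i. z i - 2 ^ n)" by (rule Suc.IH[OF t(1)])
    \<comment> \<open>The centre of the positive copy is at \<open>2 ^ n\<close>, so the copy and the whole cube have the
       same positive corner, from which \<open>z\<close> and the folded \<open>x\<close> have the same coordinates.\<close>
    also have "\<dots> = crease_sign d k (\<lambda>i. fold_coord k x i - 2 ^ Suc n)"
    proof (rule crease_sign_cong[OF k])
      fix i assume "i \<in> {1..d}"
      then show "z i - 2 ^ n = fold_coord k x i - 2 ^ Suc n"
        by (auto simp: z_def y_def L_def fold_coord_def side_def)
    qed
    finally have "s = (\<Prod>i\<in>{1..d}. side x i) * crease_sign d k (\<lambda>i. fold_coord k x i - 2 ^ Suc n)"
      unfolding t(2) L_def prod_side_eq by (rule arg_cong)
    moreover have "\<bar>x k\<bar> < 2 ^ Suc n" using inner by (auto simp: inner_faces_def)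
    from False this k have "crease_sign d k (\<lambda>i. x i - 2 ^ Suc n) =
        (\<Prod>i\<in>{1..d}. side x i) * crease_sign d k (\<lambda>i. fold_coord k x i - 2 ^ Suc n)"
      by (rule crease_sign_reflect)
    ultimately show ?thesis by (simp only:)
  qed
qed

section \<open>Windows of the structures in the hull\<close>

definition window :: "nat \<Rightarrow> nat \<Rightarrow> face set" where
  "window d n = {1..d} \<times> ({1..d} \<rightarrow>\<^sub>E {0..int n - 1})"

lemma finite_window: "finite (window d n)"
  unfolding window_def by (intro finite_cartesian_product finite_PiE) auto

lemma shift_in_faces: "f \<in> window d n \<Longrightarrow> shift d x f \<in> faces d"
  by (auto simp: window_def shift_def faces_def lattice_pts_def)

definition crease_window :: "nat \<Rightarrow> nat \<Rightarrow> (nat \<Rightarrow> int) \<Rightarrow> face \<Rightarrow> int" where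
  "crease_window d n y = (\<lambda>(k, z)\<in>window d n. crease_sign d k (\<lambda>i. y i + z i))"

text \<open>
  Base points whose window contains no face in a coordinate hyperplane. For such a face the closed
  form has no geometric meaning, because zero is divisible by all powers of two.
\<close>

definition nonsingular :: "nat \<Rightarrow> nat \<Rightarrow> (nat \<Rightarrow> int) set" where
  "nonsingular d n = {y. \<forall>(k, z)\<in>window d n. y k + z k \<noteq> 0}"

lemma cubic_subpattern_paperfolding:
  "cubic_subpattern d (paperfolding d) n x \<in> crease_window d n ` nonsingular d n"
proof -
  have "\<forall>\<^sub>F N in sequentially. \<forall>f\<in>window d n.
      finite_paperfolding d (Suc N) (shift d x f) = Some (paperfolding d (shift d x f))"
    using finite_window
  proof (rule eventually_ball_finite, intro ballI)
    fix f assume "f \<in> window d n"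
    from paperfolding_limit(1)[OF shift_in_faces[OF this]]
    show "\<forall>\<^sub>F N in sequentially.
        finite_paperfolding d (Suc N) (shift d x f) = Some (paperfolding d (shift d x f))"
      by (subst eventually_sequentially_Suc)
  qed
  then obtain N where N: "\<And>f. f \<in> window d n \<Longrightarrow>
      finite_paperfolding d (Suc N) (shift d x f) = Some (paperfolding d (shift d x f))"
    unfolding eventually_sequentially by blast
  have "cubic_subpattern d (paperfolding d) n x = crease_window d n (\<lambda>i. x i - 2 ^ N)"
    unfolding cubic_subpattern_def crease_window_def window_def[symmetric]
  proof (rule restrict_ext, clarify)
    fix k z assume kz: "(k, z) \<in> window d n"
    have "paperfolding d (shift d x (k, z)) = crease_sign d k (\<lambda>i. (\<lambda>i\<in>{1..d}. z i + x i) i - 2 ^ N)"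
      using N[OF kz] unfolding shift_def prod.case by (rule finite_paperfolding_eq_crease_sign)
    also have "\<dots> = crease_sign d k (\<lambda>i. x i - 2 ^ N + z i)"
      using kz by (intro crease_sign_cong) (auto simp: window_def)
    finally show "paperfolding d (shift d x (k, z)) = crease_sign d k (\<lambda>i. x i - 2 ^ N + z i)" .
  qed
  moreover have "(\<lambda>i. x i - 2 ^ N) \<in> nonsingular d n"
    unfolding nonsingular_def
  proof (intro CollectI ballI, clarify)
    fix k z assume kz: "(k, z) \<in> window d n" and "x k - 2 ^ N + z k = 0"
    moreover from this have "(k, \<lambda>i\<in>{1..d}. z i + x i) \<in> inner_faces d (2 ^ N)"
      using N[OF kz] finite_paperfolding_domain unfolding shift_def prod.case by blast
    ultimately show False by (auto simp: inner_faces_def faces_def)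
  qed
  ultimately show ?thesis by (rule image_eqI)
qed

text \<open>
  Basic open sets of the local topology fix the pattern on finitely many faces.
\<close>

lemma pattern_hull_agrees_on_finite:
  assumes "P \<in> pattern_hull d Q" "finite W" "W \<subseteq> faces d"
  obtains t where "t \<in> lattice_pts d" "\<And>f. f \<in> W \<Longrightarrow> P f = translate d t Q f"
proof -
  have P: "P \<in> topspace (local_topology d)"
    using assms(1) by (auto simp: pattern_hull_def in_closure_of)
  then have P': "P \<in> faces d \<rightarrow>\<^sub>E {1, -1}" by (auto simp: local_topology_def)
  define T where "T = (\<Pi>\<^sub>E f\<in>faces d. if f \<in> W then {P f} else {1, -1})"
  have "finite {f \<in> faces d. (if f \<in> W then {P f} else {1, -1}) \<noteq> {1, -1}}"
    using assms(2) by (rule rev_finite_subset) auto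
  then have "openin (local_topology d) T"
    unfolding local_topology_def T_def using P'
    by (auto simp: openin_PiE_gen PiE_iff)
  moreover have "P \<in> T" using P' by (auto simp: T_def PiE_iff)
  ultimately obtain t where "t \<in> lattice_pts d" "translate d t Q \<in> T"
    using assms(1) unfolding pattern_hull_def in_closure_of by blast
  then show ?thesis
    using assms(3) that[of t] by (fastforce simp: T_def PiE_iff split: if_splits)
qed

lemma cubic_subpatterns_hull:
  assumes "P \<in> pattern_hull d Q"
  shows "cubic_subpatterns d P n \<subseteq> cubic_subpatterns d Q n"
proof
  fix p assume "p \<in> cubic_subpatterns d P n"
  then obtain x where x: "x \<in> lattice_pts d" and p: "p = cubic_subpattern d P n x"
    by (auto simp: cubic_subpatterns_def)
  have "finite (shift d x ` window d n)" "shift d x ` window d n \<subseteq> faces d"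
    using finite_window shift_in_faces by auto
  from pattern_hull_agrees_on_finite[OF assms this]
  obtain t where t: "\<And>f. f \<in> window d n \<Longrightarrow> P (shift d x f) = translate d t Q (shift d x f)"
    by (metis imageI)
  define y where "y = (\<lambda>i\<in>{1..d}. x i - t i)"
  have "p = cubic_subpattern d Q n y"
    unfolding p cubic_subpattern_def window_def[symmetric]
  proof (rule restrict_ext)
    fix f assume f: "f \<in> window d n"
    have "shift d (\<lambda>i. - t i) (shift d x f) = shift d y f"
      by (auto simp: shift_def y_def split: prod.split)
    then show "P (shift d x f) = Q (shift d y f)"
      using t[OF f] shift_in_faces[OF f] by (simp add: translate_def)
  qed
  moreover have "y \<in> lattice_pts d" by (simp add: y_def lattice_pts_def)
  ultimately show "p \<in> cubic_subpatterns d Q n" by (auto simp: cubic_subpatterns_def)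
qed

section \<open>Counting windows\<close>

definition next_multiple :: "nat \<Rightarrow> int \<Rightarrow> int" where
  "next_multiple m a = 2 ^ m * ((a + 2 ^ m - 1) div 2 ^ m)"

lemma next_multiple_unique:
  assumes "2 ^ m dvd a + c" "0 \<le> c" "c < 2 ^ m"
  shows "next_multiple m a = a + c"
proof -
  obtain w where w: "a + c = 2 ^ m * w" using assms(1) by (elim dvdE)
  have "(a + 2 ^ m - 1) div 2 ^ m = w"
    using assms(2,3) w by (intro int_div_pos_eq[where r = "2 ^ m - 1 - c"]) auto
  then show ?thesis using w by (simp add: next_multiple_def)
qed

definition dyadic_residues :: "nat \<Rightarrow> nat \<Rightarrow> (nat \<Rightarrow> int) \<Rightarrow> (nat \<Rightarrow> int)" where
  "dyadic_residues d m y = (\<lambda>i\<in>{1..d}. y i mod 2 ^ Suc m)"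

text \<open>
  The part of the code of a window that describes its faces in hyperplanes of high dyadic order:
  \<open>k\<close> is the axis of the hyperplane, and the entry is the digit of coordinate \<open>i\<close> read by the faces
  that lie, in direction \<open>i\<close>, before (\<open>h = 0\<close>) or after (\<open>h = 1\<close>) the first multiple of \<open>2\<^sup>m\<close>
  greater than \<open>y\<^sub>i\<close>. The lowest \<open>m\<close> digits are cut off, which lowers the index by \<open>m\<close>.
\<close>

definition coarse_bits :: "nat \<Rightarrow> nat \<Rightarrow> (nat \<Rightarrow> int) \<Rightarrow> (nat \<times> nat \<times> int \<Rightarrow> bool)" where
  "coarse_bits d m y = (\<lambda>(k, i, h)\<in>{1..d} \<times> {1..d} \<times> {0, 1}.
     let v = multiplicity 2 (next_multiple m (y k))
     in bit (y i div 2 ^ m + h) ((if i < k then v else Suc v) - m))"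

text \<open>
  A face whose \<open>k\<close>-th coordinate is not divisible by \<open>2\<^sup>m\<close> reads digits at most \<open>m\<close>, which are known
  from the residues modulo \<open>2\<^sup>m\<^sup>+\<^sup>1\<close>. For the others the \<open>k\<close>-th coordinate is the unique multiple of
  \<open>2\<^sup>m\<close> in the window, which may have different dyadic orders for \<open>y\<close> and \<open>y'\<close>; but the digits read
  there are entries of \<open>coarse_bits\<close>.
\<close>

lemma crease_window_determined:
  assumes "int n \<le> 2 ^ m" "dyadic_residues d m y = dyadic_residues d m y'" "coarse_bits d m y = coarse_bits d m y'"
    and "y \<in> nonsingular d n" "y' \<in> nonsingular d n"
  shows "crease_window d n y = crease_window d n y'"
  unfolding crease_window_def
proof (rule restrict_ext, clarify)
  fix k z assume kz: "(k, z) \<in> window d n"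
  then have k: "k \<in> {1..d}" by (auto simp: window_def)
  have z: "0 \<le> z i" "z i < 2 ^ m" if "i \<in> {1..d}" for i
  proof -
    have "z i \<in> {0..int n - 1}" using kz that by (auto simp: window_def PiE_iff)
    then show "0 \<le> z i" "z i < 2 ^ m" using assms(1) by (simp, metis atLeastAtMost_iff le_less_trans less_le_trans zle_diff1_eq)
  qed
  have res: "y i mod 2 ^ Suc m = y' i mod 2 ^ Suc m" if "i \<in> {1..d}" for i
    using fun_cong[OF assms(2), of i] that by (simp add: dyadic_residues_def)
  have mod: "(y i + z i) mod 2 ^ Suc m = (y' i + z i) mod 2 ^ Suc m" if "i \<in> {1..d}" for i
    using res[OF that] by (rule mod_add_cong) (rule refl)
  have mod_m: "a mod 2 ^ m = b mod 2 ^ m" if "a mod 2 ^ Suc m = b mod 2 ^ Suc m" for a b :: int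
    using arg_cong[OF that, of "\<lambda>a. a mod 2 ^ m"] le_imp_power_dvd[of m "Suc m" "2 :: int"]
    by (simp add: mod_mod_cancel del: power_Suc)
  let ?v = "multiplicity 2 (y k + z k)" and ?v' = "multiplicity 2 (y' k + z k)"
  have bits: "bit (y i + z i) (if i < k then ?v else Suc ?v) \<longleftrightarrow>
      bit (y' i + z i) (if i < k then ?v' else Suc ?v')" if i: "i \<in> {1..d}" for i
  proof (cases "2 ^ m dvd y k + z k")
    case False
    then have "?v = ?v'" "?v < m"
      using multiplicity_2_cong[OF mod_m[OF mod[OF k]]] by auto
    then show ?thesis using bit_cong_mod_power[OF mod[OF i]] by auto
  next
    case True
    then have True': "2 ^ m dvd y' k + z k"
      using mod_m[OF mod[OF k]] by (simp add: dvd_eq_mod_eq_0)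
    have "y k + z k \<noteq> 0" "y' k + z k \<noteq> 0" using assms(4,5) kz by (auto simp: nonsingular_def)
    then have vm: "m \<le> ?v" "m \<le> ?v'" using True True' le_multiplicity_2_iff by blast+
    have X: "next_multiple m (y k) = y k + z k" "next_multiple m (y' k) = y' k + z k"
      using next_multiple_unique[OF _ z[OF k]] True True' by blast+
    \<comment> \<open>The carry into digit \<open>m\<close>: it tells on which side of the first multiple of \<open>2 ^ m\<close> greater
       than \<open>y i\<close> the face lies, and it depends on \<open>y i\<close> only through its residue.\<close>
    define h where "h = (y i mod 2 ^ m + z i) div 2 ^ m"
    have h': "h = (y' i mod 2 ^ m + z i) div 2 ^ m"
      using mod_m[OF res[OF i]] by (simp add: h_def)
    have "0 \<le> y i mod 2 ^ m" "y i mod 2 ^ m < 2 ^ m" by auto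
    then have "0 \<le> y i mod 2 ^ m + z i" "y i mod 2 ^ m + z i < 2 * 2 ^ m"
      using z[OF i] by linarith+
    then have h: "h \<in> {0, 1}"
      unfolding h_def
      using int_div_pos_eq[of "y i mod 2 ^ m + z i" "2 ^ m" 1 "y i mod 2 ^ m + z i - 2 ^ m"]
      by (cases "y i mod 2 ^ m + z i < 2 ^ m") auto
    have carry: "(a + c) div 2 ^ m = a div 2 ^ m + (a mod 2 ^ m + c) div 2 ^ m" for a c :: int
    proof -
      have "a + c = a mod 2 ^ m + c + a div 2 ^ m * 2 ^ m"
        using div_mult_mod_eq[of a "2 ^ m"] by linarith
      then have "(a + c) div 2 ^ m = (a mod 2 ^ m + c + a div 2 ^ m * 2 ^ m) div 2 ^ m"
        by (rule arg_cong)
      also have "\<dots> = a div 2 ^ m + (a mod 2 ^ m + c) div 2 ^ m"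
        by (rule div_mult_self1) simp
      finally show ?thesis .
    qed
    have coarse: "(y i + z i) div 2 ^ m = y i div 2 ^ m + h"
        "(y' i + z i) div 2 ^ m = y' i div 2 ^ m + h"
      using carry[of "y i" "z i"] carry[of "y' i" "z i"] unfolding h_def[symmetric] h'[symmetric] .
    have high: "bit a j \<longleftrightarrow> bit (a div 2 ^ m) (j - m)" if "m \<le> j" for a :: int and j
      using that by (simp add: bit_drop_bit_eq flip: drop_bit_eq_div)
    have "bit (y i div 2 ^ m + h) ((if i < k then ?v else Suc ?v) - m) \<longleftrightarrow>
        bit (y' i div 2 ^ m + h) ((if i < k then ?v' else Suc ?v') - m)"
    proof -
      have "coarse_bits d m w (k, i, h) = (let v = multiplicity 2 (next_multiple m (w k))
          in bit (w i div 2 ^ m + h) ((if i < k then v else Suc v) - m))" for w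
        using k i h by (simp add: coarse_bits_def)
      from this[of y] this[of y'] show ?thesis using assms(3) unfolding Let_def X by simp
    qed
    moreover have "m \<le> (if i < k then ?v else Suc ?v)" "m \<le> (if i < k then ?v' else Suc ?v')"
      using vm by simp_all
    ultimately show ?thesis by (simp only: high coarse)
  qed
  show "crease_sign d k (\<lambda>i. y i + z i) = crease_sign d k (\<lambda>i. y' i + z i)"
    unfolding crease_sign_def using bits by (intro prod.cong) (auto simp: bit_sign_def)
qed

lemma card_image_le_of_determined:
  assumes "finite R" "g ` Y \<subseteq> R" "\<And>y y'. y \<in> Y \<Longrightarrow> y' \<in> Y \<Longrightarrow> g y = g y' \<Longrightarrow> f y = f y'"
  shows "finite (f ` Y)" "card (f ` Y) \<le> card R"
proof -
  have "f y = f (inv_into Y g (g y))" if "y \<in> Y" for y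
    using that by (intro assms(3)) (auto simp: inv_into_into f_inv_into_f)
  then have "f ` Y = (\<lambda>c. f (inv_into Y g c)) ` g ` Y"
    unfolding image_image by (rule image_cong[OF refl])
  moreover have "finite (g ` Y)" "card (g ` Y) \<le> card R"
    using assms(1,2) finite_subset card_mono by auto
  ultimately show "finite (f ` Y)" "card (f ` Y) \<le> card R"
    using card_image_le[of "g ` Y"] by (simp, metis le_trans)
qed

lemma card_crease_windows:
  assumes "int n \<le> 2 ^ m"
  shows "finite (crease_window d n ` nonsingular d n)"
    and "card (crease_window d n ` nonsingular d n) \<le> (2 ^ Suc m) ^ d * 2 ^ (2 * d\<^sup>2)"
proof -
  let ?A = "{1..d} \<rightarrow>\<^sub>E {0..<2 ^ Suc m :: int}"
  let ?B = "({1..d} \<times> {1..d} \<times> {0, 1 :: int}) \<rightarrow>\<^sub>E (UNIV :: bool set)"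
  have fin: "finite (?A \<times> ?B)" by (intro finite_cartesian_product finite_PiE) auto
  have R: "(\<lambda>y. (dyadic_residues d m y, coarse_bits d m y)) ` nonsingular d n \<subseteq> ?A \<times> ?B"
  proof (intro image_subsetI SigmaI)
    show "dyadic_residues d m y \<in> ?A" for y
      unfolding dyadic_residues_def by (intro restrict_PiE_iff[THEN iffD2]) simp
    show "coarse_bits d m y \<in> ?B" for y
      unfolding coarse_bits_def by (intro restrict_PiE_iff[THEN iffD2]) blast
  qed
  have "card ?A = (2 ^ Suc m) ^ d"
    by (simp add: card_PiE nat_power_eq del: power_Suc)
  moreover have "card ?B = 2 ^ (2 * d\<^sup>2)"
    by (subst card_PiE) (simp_all add: card_cartesian_product power2_eq_square mult_ac)
  ultimately have card: "card (?A \<times> ?B) = (2 ^ Suc m) ^ d * 2 ^ (2 * d\<^sup>2)"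
    by (simp only: card_cartesian_product)
  have determined: "crease_window d n y = crease_window d n y'"
    if "y \<in> nonsingular d n" "y' \<in> nonsingular d n"
      "(dyadic_residues d m y, coarse_bits d m y) = (dyadic_residues d m y', coarse_bits d m y')" for y y'
    using that by (intro crease_window_determined[OF assms]) simp_all
  show "finite (crease_window d n ` nonsingular d n)"
    using fin R determined by (rule card_image_le_of_determined(1))
  have "card (crease_window d n ` nonsingular d n) \<le> card (?A \<times> ?B)"
    using fin R determined by (rule card_image_le_of_determined(2))
  then show "card (crease_window d n ` nonsingular d n) \<le> (2 ^ Suc m) ^ d * 2 ^ (2 * d\<^sup>2)"
    unfolding card .
qed

theorem theorem3:
  fixes d :: nat
  assumes "d \<ge> 1"
  shows "\<exists>C::real. \<forall>P\<in>paperfolding_structures d. \<forall>n::nat. n \<ge> 1 \<longrightarrow>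
           finite (cubic_subpatterns d P n) \<and>
           real (card (cubic_subpatterns d P n)) \<le> C * real n ^ d"
proof (intro exI ballI allI impI)
  fix P and n :: nat
  assume P: "P \<in> paperfolding_structures d" and n: "n \<ge> 1"
  \<comment> \<open>The window size is at most \<open>2 ^ m\<close> for \<open>m = Suc a\<close>, and \<open>2 ^ Suc m \<le> 4 * n\<close>.\<close>
  obtain a where a: "2 ^ a \<le> n" "n < 2 ^ (a + 1)"
    using ex_power_ivl1[of 2 n] n by auto
  then have n2: "int n \<le> 2 ^ Suc a" using of_nat_less_iff[of n "2 ^ Suc a", where 'a = int] by simp
  have sub: "cubic_subpatterns d P n \<subseteq> crease_window d n ` nonsingular d n"
  proof (rule order_trans)
    show "cubic_subpatterns d P n \<subseteq> cubic_subpatterns d (paperfolding d) n"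
      using P unfolding paperfolding_structures_def by (rule cubic_subpatterns_hull)
    show "cubic_subpatterns d (paperfolding d) n \<subseteq> crease_window d n ` nonsingular d n"
      unfolding cubic_subpatterns_def by (intro image_subsetI cubic_subpattern_paperfolding)
  qed
  note count = card_crease_windows[OF n2, of d]
  have "card (cubic_subpatterns d P n) \<le> (2 ^ Suc (Suc a)) ^ d * 2 ^ (2 * d\<^sup>2)"
    using card_mono[OF count(1) sub] count(2) by (rule le_trans)
  also have "\<dots> \<le> (4 * n) ^ d * 2 ^ (2 * d\<^sup>2)"
    using a by (intro mult_right_mono power_mono) auto
  finally have "real (card (cubic_subpatterns d P n)) \<le> real ((4 * n) ^ d * 2 ^ (2 * d\<^sup>2))"
    by (rule of_nat_mono)
  then show "finite (cubic_subpatterns d P n) \<and>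
      real (card (cubic_subpatterns d P n)) \<le> 4 ^ d * 2 ^ (2 * d\<^sup>2) * real n ^ d"
    using finite_subset[OF sub count(1)] by (simp add: power_mult_distrib mult_ac)
qed

end
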